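(* For $s\in[0,1]$ let $P_0,P_1,P_2,P_3(s),P_4,P_5,P_6\in\mathbb{R}^3$ be the points $$P_0=(0,9,20),\ P_1=(-15,-95,-50),\ P_2=(40,80,-20),\ P_3(s)=(-10+20s,-60,58),$$ $$P_4=(-60,30,20),\ P_5=(40,-60,-60),\ P_6=(0,9,20),$$ and let $\mathcal{C}_s:[0,1]\to\mathbb{R}^3$ be the closed Bézier curve of degree $6$ with these control points (in this order). Then there exists $s\in[0,1]$ such that $\mathcal{C}_s$ has a self-intersection, i.e. there are $t_1<t_2$ in $[0,1]$ with $(t_1,t_2)\neq(0,1)$ and $\mathcal{C}_s(t_1)=\mathcal{C}_s(t_2)$.
   Context: The Bézier curve of degree $n$ with control points $P_0,\dots,P_n\in\mathbb{R}^3$ is $\mathcal{C}(t)=\sum_{i=0}^n \binom{n}{i}t^i(1-t)^{n-i}P_i$, $t\in[0,1]$. The linear perturbation $s\mapsto P_3(s)$ moves the vertex $(-10,-60,58)$ to $(10,-60,58)$ and is the perturbation that carries the closed piecewise linear (PL) curve $K_0$ (the control polygon for $s=0$) to $K_1$ (the control polygon for $s=1$); all other vertices are fixed. Since $P_0=P_6$, every $\mathcal{C}_s$ is closed, and the coincidence $\mathcal{C}_s(0)=\mathcal{C}_s(1)$ does not count as a self-intersection. *)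

theory Defs
  imports "HOL-Analysis.Analysis"
begin

text \<open>The Bezier curve of degree \<^term>\<open>n\<close>; control points \<^term>\<open>P i\<close> with
  \<^term>\<open>i > n\<close> are ignored. A total function of the parameter, of interest only on
  \<^term>\<open>{0..1::real}\<close>.\<close>

definition bezier :: "nat \<Rightarrow> (nat \<Rightarrow> 'a::real_vector) \<Rightarrow> real \<Rightarrow> 'a" where
  "bezier n P t = (\<Sum>i\<le>n. Bernstein n i t *\<^sub>R P i)"

definition control_points :: "real \<Rightarrow> (real ^ 3) list" where
  "control_points s =
    [vector [0, 9, 20],
     vector [-15, -95, -50],
     vector [40, 80, -20],
     vector [-10 + 20 * s, -60, 58],
     vector [-60, 30, 20],
     vector [40, -60, -60],
     vector [0, 9, 20]]"

definition perturbed_curve :: "real \<Rightarrow> real \<Rightarrow> real ^ 3" where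
  "perturbed_curve s = bezier 6 (\<lambda>i. control_points s ! i)"

lemma perturbed_curve_closed: "perturbed_curve s 0 = perturbed_curve s 1"
  by (simp add: perturbed_curve_def bezier_def Bernstein_def control_points_def
      numeral_eq_Suc)

end

theory Submission
  imports Defs
begin

text \<open>The perturbation only affects first coordinates. In terms of \<open>u = t\<^sub>1 + t\<^sub>2\<close> and
  \<open>v = t\<^sub>1 * t\<^sub>2\<close>, the divided difference of a sextic is quadratic in \<open>v\<close> with coefficients
  polynomial in \<open>u\<close>. Eliminating \<open>v\<^sup>2\<close> from the equations for the second and third coordinates
  gives \<open>v\<close> as a rational function of \<open>u\<close>, and the intermediate value theorem locates a value of
  \<open>u\<close> at which both equations hold. The equation for the first coordinate is linear in \<open>s\<close>, and
  the estimates for \<open>u\<close> and \<open>v\<close> place its solution in the unit interval.\<close>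

definition sextic :: "real \<Rightarrow> real \<Rightarrow> real \<Rightarrow> real \<Rightarrow> real \<Rightarrow> real \<Rightarrow> real \<Rightarrow> real \<Rightarrow> real" where
  "sextic c0 c1 c2 c3 c4 c5 c6 t =
    c0 + c1 * t + c2 * t^2 + c3 * t^3 + c4 * t^4 + c5 * t^5 + c6 * t^6"

text \<open>Each quotient \<open>(x^k - y^k) / (x - y)\<close> is symmetric, hence a polynomial in
  \<open>u = x + y\<close> and \<open>v = x * y\<close>: for \<open>k\<close> from 3 to 6 it is
  \<open>u^2 - v\<close>, \<open>u^3 - 2*u*v\<close>, \<open>u^4 - 3*u^2*v + v^2\<close>,
  \<open>u^5 - 4*u^3*v + 3*u*v^2\<close>.\<close>

definition secant :: "real \<Rightarrow> real \<Rightarrow> real \<Rightarrow> real \<Rightarrow> real \<Rightarrow> real \<Rightarrow> real \<Rightarrow> real \<Rightarrow> real" where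
  "secant c1 c2 c3 c4 c5 c6 u v =
    (c1 + c2 * u + c3 * u^2 + c4 * u^3 + c5 * u^4 + c6 * u^5)
    - (c3 + 2 * c4 * u + 3 * c5 * u^2 + 4 * c6 * u^3) * v
    + (c5 + 3 * c6 * u) * v^2"

lemma sextic_diff:
  "sextic c0 c1 c2 c3 c4 c5 c6 x - sextic c0 c1 c2 c3 c4 c5 c6 y
    = (x - y) * secant c1 c2 c3 c4 c5 c6 (x + y) (x * y)"
  unfolding sextic_def secant_def by algebra

lemma sextic_eqI:
  assumes "secant c1 c2 c3 c4 c5 c6 (x + y) (x * y) = 0"
  shows "sextic c0 c1 c2 c3 c4 c5 c6 x = sextic c0 c1 c2 c3 c4 c5 c6 y"
  using sextic_diff[of c0 c1 c2 c3 c4 c5 c6 x y] assms by simp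

lemma perturbed_curve_nth:
  "perturbed_curve s t $ k = (\<Sum>i\<le>6. Bernstein 6 i t * (control_points s ! i $ k))"
  by (simp add: perturbed_curve_def bezier_def)

text \<open>Change to the monomial basis: the coefficient of \<open>t^k\<close> is
  \<open>6 choose k\<close> times the \<open>k\<close>-th forward difference of \<open>p\<close> at
  0.\<close>

lemma Bernstein_sextic_sum:
  "(\<Sum>i\<le>6. Bernstein 6 i t * p i) = sextic (p 0)
    (6 * (p 1 - p 0))
    (15 * (p 2 - 2 * p 1 + p 0))
    (20 * (p 3 - 3 * p 2 + 3 * p 1 - p 0))
    (15 * (p 4 - 4 * p 3 + 6 * p 2 - 4 * p 1 + p 0))
    (6 * (p 5 - 5 * p 4 + 10 * p 3 - 10 * p 2 + 5 * p 1 - p 0))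
    (p 6 - 6 * p 5 + 15 * p 4 - 20 * p 3 + 15 * p 2 - 6 * p 1 + p 0) t"
proof -
  have ch: "6 choose 2 = (15::nat)" "6 choose 3 = (20::nat)" "6 choose 4 = (15::nat)"
    "6 choose 5 = (6::nat)" "6 choose (Suc 0) = (6::nat)"
    by (simp_all add: eval_nat_numeral)
  have set6: "{..6::nat} = {0, 1, 2, 3, 4, 5, 6}"
    by auto
  show ?thesis
    unfolding set6 by (simp add: Bernstein_def sextic_def ch) algebra
qed

lemma perturbed_curve_1:
  "perturbed_curve s t $ 1 = sextic 0 (-90) 1050 (400 * s - 3500) (4200 - 1200 * s)
    (1200 * s - 1410) (- 250 - 400 * s) t"
  unfolding perturbed_curve_nth Bernstein_sextic_sum
  by (simp add: control_points_def vector_3 nth_Cons_numeral algebra_simps)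

lemma perturbed_curve_2:
  "perturbed_curve s t $ 2 = sextic 9 (-624) 4185 (-11880) 17085 (-12564) 3798 t"
  unfolding perturbed_curve_nth Bernstein_sextic_sum
  by (simp add: control_points_def vector_3)

lemma perturbed_curve_3:
  "perturbed_curve s t $ 3 = sextic 20 (-420) 1500 (-1040) (-1680) 2100 (-460) t"
  unfolding perturbed_curve_nth Bernstein_sextic_sum
  by (simp add: control_points_def vector_3)

text \<open>Eliminating the square from the two quadratics leaves \<open>D * x = N\<close>, and
  \<open>res\<close> says that their resultant vanishes.\<close>

lemma common_root_quadratics:
  fixes a0 a1 a2 b0 b1 b2 :: real
  defines "N \<equiv> a2 * b0 - a0 * b2" and "D \<equiv> a1 * b2 - a2 * b1"
  assumes "D \<noteq> 0" and res: "N^2 = (a0 * b1 - a1 * b0) * D"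
  shows "a0 + a1 * (N / D) + a2 * (N / D)^2 = 0"
    and "b0 + b1 * (N / D) + b2 * (N / D)^2 = 0"
proof -
  have sq: "(N / D)^2 = (a0 * b1 - a1 * b0) / D"
    unfolding power_divide res using \<open>D \<noteq> 0\<close> by (simp add: power2_eq_square)
  have clear: "x + y * (N / D) + z * (q / D) = (x * D + y * N + z * q) / D" for x y z q
    using \<open>D \<noteq> 0\<close> by (simp add: add_divide_distrib)
  \<comment> \<open>The vector \<open>(D, N, a0 * b1 - a1 * b0)\<close> is the cross product of
    \<open>(a0, a1, a2)\<close> and \<open>(b0, b1, b2)\<close>, so it is orthogonal to
    both.\<close>
  have "a0 * D + a1 * N + a2 * (a0 * b1 - a1 * b0) = 0"
    "b0 * D + b1 * N + b2 * (a0 * b1 - a1 * b0) = 0"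
    unfolding N_def D_def by algebra+
  then show "a0 + a1 * (N / D) + a2 * (N / D)^2 = 0" "b0 + b1 * (N / D) + b2 * (N / D)^2 = 0"
    unfolding sq clear by simp_all
qed

lemma common_secant_zero:
  obtains u v :: real where "0.52159 \<le> u" "u \<le> 0.5216" "0.015 \<le> v" "v \<le> 0.016"
    "secant (-624) 4185 (-11880) 17085 (-12564) 3798 u v = 0"
    "secant (-420) 1500 (-1040) (-1680) 2100 (-460) u v = 0"
proof -
  \<comment> \<open>Coefficients in \<open>v\<close> of the two secants, divided by 3 for the second
    coordinate and by 20 for the third.\<close>
  define a0 a1 a2 where
    "a0 = (\<lambda>u::real. - 208 + 1395 * u - 3960 * u^2 + 5695 * u^3 - 4188 * u^4 + 1266 * u^5)"
    and "a1 = (\<lambda>u::real. 3960 - 11390 * u + 12564 * u^2 - 5064 * u^3)"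
    and "a2 = (\<lambda>u::real. - 4188 + 3798 * u)"
  define b0 b1 b2 where
    "b0 = (\<lambda>u::real. - 21 + 75 * u - 52 * u^2 - 84 * u^3 + 105 * u^4 - 23 * u^5)"
    and "b1 = (\<lambda>u::real. 52 + 168 * u - 315 * u^2 + 92 * u^3)"
    and "b2 = (\<lambda>u::real. 105 - 69 * u)"
  note coeffs = a0_def a1_def a2_def b0_def b1_def b2_def
  define N D where "N = (\<lambda>u. a2 u * b0 u - a0 u * b2 u)" and "D = (\<lambda>u. a1 u * b2 u - a2 u * b1 u)"
  \<comment> \<open>The resultant in \<open>v\<close> of the two quadratics.\<close>
  define R where "R = (\<lambda>u. (N u)^2 - (a0 u * b1 u - a1 u * b0 u) * D u)"
  have "\<exists>u. 0.52159 \<le> u \<and> u \<le> 0.5216 \<and> R u = 0"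
  proof (rule IVT')
    show "R 0.52159 \<le> 0" "0 \<le> R 0.5216"
      unfolding R_def N_def D_def coeffs by (simp_all add: power_divide)
    show "continuous_on {0.52159..0.5216} R"
      unfolding R_def N_def D_def coeffs by (intro continuous_intros)
  qed simp
  then obtain u where u: "0.52159 \<le> u" "u \<le> 0.5216" and "R u = 0"
    by blast
  have pow: "0.52159^k \<le> u^k" "u^k \<le> 0.5216^k" for k
    using u by (auto intro!: power_mono)
  \<comment> \<open>The interval is so short that the powers of \<open>u\<close> can be bounded
    independently, which leaves linear arithmetic.\<close>
  note bounds = u pow[of 2, simplified power_divide] pow[of 3, simplified power_divide]
    pow[of 4, simplified power_divide] pow[of 5, simplified power_divide]
  \<comment> \<open>Expanding first matters: the leading terms, of degree 6 in \<open>N\<close> and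
    4 in \<open>D\<close>, cancel.\<close>
  have N: "N u = 109788 - 554685 * u + 1014681 * u^2 - 716919 * u^3 + 73923 * u^4 + 73212 * u^5"
    unfolding N_def coeffs by algebra
  have D: "D u = 633576 - 963102 * u + 147846 * u^2 + 183030 * u^3"
    unfolding D_def coeffs by algebra
  have "0 < D u" "0.015 * D u \<le> N u" "N u \<le> 0.016 * D u"
    unfolding N D using bounds by simp_all
  then have v: "0.015 \<le> N u / D u" "N u / D u \<le> 0.016"
    by (simp_all add: pos_le_divide_eq pos_divide_le_eq)
  have "a0 u + a1 u * (N u / D u) + a2 u * (N u / D u)^2 = 0"
    "b0 u + b1 u * (N u / D u) + b2 u * (N u / D u)^2 = 0"
    using \<open>0 < D u\<close> \<open>R u = 0\<close> unfolding R_def N_def D_def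
    by (intro common_root_quadratics; simp)+
  then have
    "secant (-624) 4185 (-11880) 17085 (-12564) 3798 u (N u / D u) = 0"
    "secant (-420) 1500 (-1040) (-1680) 2100 (-460) u (N u / D u) = 0"
    unfolding secant_def coeffs by algebra+
  then show thesis
    using that u v by blast
qed

lemma secant_zero_perturbation:
  fixes u v :: real
  assumes u: "0.52159 \<le> u" "u \<le> 0.5216" and v: "0.015 \<le> v" "v \<le> 0.016"
  obtains s where "s \<in> {0..1}"
    "secant (-90) 1050 (400 * s - 3500) (4200 - 1200 * s) (1200 * s - 1410) (- 250 - 400 * s) u v = 0"
proof -
  define X where "X = secant (-90) 1050 (-3500) 4200 (-1410) (-250) u v"
  \<comment> \<open>The part linear in \<open>s\<close> of the first coordinate is
    \<open>400 * s * t^3 * (1 - t)^3\<close>; \<open>B\<close> is its secant for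
    \<open>s = 1\<close>.\<close>
  define B where "B = secant 0 0 400 (-1200) 1200 (-400) u v"
  have lin: "secant (-90) 1050 (400 * s - 3500) (4200 - 1200 * s) (1200 * s - 1410)
      (- 250 - 400 * s) u v = X + s * B" for s
    unfolding secant_def X_def B_def by algebra
  have pow: "0.52159^k \<le> u^k" "u^k \<le> 0.5216^k" for k
    using u by (auto intro!: power_mono)
  note bounds = u pow[of 2, simplified power_divide] pow[of 3, simplified power_divide]
    pow[of 4, simplified power_divide] pow[of 5, simplified power_divide]
  \<comment> \<open>Bounds on the coefficients of 1, \<open>v\<close> and \<open>v^2\<close>, first
    in \<open>X\<close>, then in \<open>B\<close>.\<close>
  have coeff_bounds:
    "- 13 \<le> - 90 + 1050 * u - 3500 * u^2 + 4200 * u^3 - 1410 * u^4 - 250 * u^5"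
    "- 90 + 1050 * u - 3500 * u^2 + 4200 * u^3 - 1410 * u^4 - 250 * u^5 \<le> - 12"
    "411 \<le> 3500 - 8400 * u + 4230 * u^2 + 1000 * u^3"
    "3500 - 8400 * u + 4230 * u^2 + 1000 * u^3 \<le> 412"
    "- 1802 \<le> - 1410 - 750 * u" "- 1410 - 750 * u \<le> 0"
    "11 \<le> 400 * u^2 - 1200 * u^3 + 1200 * u^4 - 400 * u^5"
    "99 \<le> - 400 + 2400 * u - 3600 * u^2 + 1600 * u^3"
    "0 \<le> 1200 - 1200 * u"
    using bounds by simp_all
  have v2: "v^2 \<le> 0.016^2" and "0 \<le> v^2"
    using v by (intro power_mono) auto
  have mid: "411 * 0.015 \<le> (3500 - 8400 * u + 4230 * u^2 + 1000 * u^3) * v"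
    "(3500 - 8400 * u + 4230 * u^2 + 1000 * u^3) * v \<le> 412 * 0.016"
    "99 * 0.015 \<le> (- 400 + 2400 * u - 3600 * u^2 + 1600 * u^3) * v"
    using coeff_bounds v by (intro mult_mono; linarith)+
  have top: "- 1802 * 0.016^2 \<le> (- 1410 - 750 * u) * v^2" "(- 1410 - 750 * u) * v^2 \<le> 0"
    "0 \<le> (1200 - 1200 * u) * v^2"
  proof -
    have "(1410 + 750 * u) * v^2 \<le> 1802 * 0.016^2"
      using coeff_bounds v2 by (intro mult_mono) auto
    then show "- 1802 * 0.016^2 \<le> (- 1410 - 750 * u) * v^2"
      by (simp add: algebra_simps)
    show "(- 1410 - 750 * u) * v^2 \<le> 0" "0 \<le> (1200 - 1200 * u) * v^2"
      using coeff_bounds by (auto intro: mult_nonpos_nonneg mult_nonneg_nonneg)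
  qed
  have X_eq: "X = (- 90 + 1050 * u - 3500 * u^2 + 4200 * u^3 - 1410 * u^4 - 250 * u^5)
      + (3500 - 8400 * u + 4230 * u^2 + 1000 * u^3) * v + (- 1410 - 750 * u) * v^2"
    unfolding X_def secant_def by algebra
  have B_eq: "B = (400 * u^2 - 1200 * u^3 + 1200 * u^4 - 400 * u^5)
      + (- 400 + 2400 * u - 3600 * u^2 + 1600 * u^3) * v + (1200 - 1200 * u) * v^2"
    unfolding B_def secant_def by algebra
  have "- 13 + 411 * 0.015 - 1802 * 0.016^2 \<le> X" "X \<le> - 12 + 412 * 0.016"
    unfolding X_eq using coeff_bounds(1,2) mid(1,2) top(1,2) by linarith+
  then have "- 8 \<le> X" "X \<le> 0"
    by (simp_all add: power_divide)
  have "11 + 99 * 0.015 \<le> B"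
    unfolding B_eq using coeff_bounds(7) mid(3) top(3) by linarith
  then have "11 \<le> B"
    by simp
  \<comment> \<open>The root of \<open>X + s * B\<close> is \<open>- X / B\<close>, which lies
    between 0 and 8/11.\<close>
  with \<open>- 8 \<le> X\<close> \<open>X \<le> 0\<close> have "- X / B \<in> {0..1}" "X + (- X / B) * B = 0"
    by (auto simp: field_simps)
  then show thesis
    using that lin by metis
qed

theorem theorem8p2:
  shows "\<exists>s\<in>{0..1}. \<exists>t\<^sub>1\<in>{0..1}. \<exists>t\<^sub>2\<in>{0..1}.
    t\<^sub>1 < t\<^sub>2 \<and> (t\<^sub>1, t\<^sub>2) \<noteq> (0, 1) \<and>
    perturbed_curve s t\<^sub>1 = perturbed_curve s t\<^sub>2"
proof -
  obtain u v :: real where u: "0.52159 \<le> u" "u \<le> 0.5216" and v: "0.015 \<le> v" "v \<le> 0.016"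
    and y: "secant (-624) 4185 (-11880) 17085 (-12564) 3798 u v = 0"
    and z: "secant (-420) 1500 (-1040) (-1680) 2100 (-460) u v = 0"
    by (rule common_secant_zero)
  obtain s where s: "s \<in> {0..1}" and x: "secant (-90) 1050 (400 * s - 3500) (4200 - 1200 * s)
      (1200 * s - 1410) (- 250 - 400 * s) u v = 0"
    using secant_zero_perturbation[OF u v] by blast
  \<comment> \<open>The parameters are the roots of \<open>T^2 - u * T + v\<close>.\<close>
  define r where "r = sqrt (u^2 - 4 * v)"
  define t1 t2 where "t1 = (u - r) / 2" and "t2 = (u + r) / 2"
  have "0.52159^2 \<le> u^2"
    using u by (intro power_mono) auto
  then have disc: "0 < u^2 - 4 * v"
    using v by (simp add: power_divide)
  then have r2: "r^2 = u^2 - 4 * v" and "0 < r"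
    by (simp_all add: r_def)
  have "r < u"
    using r2 u v by (intro power2_less_imp_less[of r u]) auto
  have sum: "t1 + t2 = u"
    by (simp add: t1_def t2_def field_simps)
  have "t1 * t2 = (u^2 - r^2) / 4"
    by (simp add: t1_def t2_def power2_eq_square algebra_simps)
  then have prod: "t1 * t2 = v"
    by (simp add: r2)
  \<comment> \<open>From \<open>0 < r < u < 1\<close> follows \<open>0 < t1 < t2 < 1\<close>, so the
    closing point of the curve is avoided.\<close>
  have t: "t1 \<in> {0..1}" "t2 \<in> {0..1}" "t1 < t2" "(t1, t2) \<noteq> (0, 1)"
    using \<open>0 < r\<close> \<open>r < u\<close> u by (auto simp: t1_def t2_def)
  have "perturbed_curve s t1 = perturbed_curve s t2"
    unfolding vec_eq_iff forall_3 perturbed_curve_1 perturbed_curve_2 perturbed_curve_3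
    using x y z by (auto intro!: sextic_eqI simp: sum prod)
  with s t show ?thesis
    by blast
qed

end
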